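(* Let $t\ge2$, let $0\le a<b<t$ be integers satisfying $a+b\ge t$, and let $I_r=2^r\mathbb{L}_{2^t}$ for each $r$. Then the two disjoint sets $X=I_a\setminus I_b$ and $Y=I_b\setminus\{0\}$ are completely joined in $G_{2^t}$ (every element of $X$ is adjacent to every element of $Y$). Consequently $G_{2^t}$ contains a (not necessarily induced) subgraph $K_{m_{a,b},n_b}$, where $$m_{a,b}=2^{4(t-a)}-2^{4(t-b)},\qquad n_b=2^{4(t-b)}-1.$$ In particular, $$\rho(A_{2^t})\ge\sqrt{m_{a,b}n_b}\qquad\text{and}\qquad |E(G_{2^t})|\ge m_{a,b}n_b.$$
   Context: For $n\ge2$, $\mathbb{L}_n=\{a+bi+cj+dk: a,b,c,d\in\mathbb{Z}/n\mathbb{Z}\}$ is the ring of Lipschitz quaternions modulo $n$, with the usual relations $i^2=j^2=k^2=-1$, $ij=k=-ji$, $jk=i=-kj$, $ki=j=-ik$ taken modulo $n$. A nonzero element $x$ of a ring is a zero divisor if $xy=0$ or $yx=0$ for some nonzero $y$. $G_n=\Gamma(\mathbb{L}_n)$ is the simple undirected graph whose vertices are the nonzero zero divisors of $\mathbb{L}_n$, distinct $x,y$ being adjacent iff $xy=0$ or $yx=0$; $A_n=A(G_n)$ is its adjacency matrix. $\rho$ denotes the spectral radius; $K_{m,n}$ is the complete bipartite graph. *)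

theory Defs
  imports
    Complex_Main
    "HOL-Algebra.Ring"
    "Graph_Theory.Graph_Theory"
    "Jordan_Normal_Form.Spectral_Radius"
begin

text \<open>
  The quaternion \<open>a + b i + c j + d k\<close> over \<open>\<int>/n\<int>\<close> is the tuple \<open>(a, b, c, d)\<close> of canonical
  representatives in \<open>{0..<n}\<close>. The product is the bilinear extension of
  \<open>i^2 = j^2 = k^2 = -1\<close>, \<open>ij = k = -ji\<close>, \<open>jk = i = -kj\<close>, \<open>ki = j = -ik\<close>
  (see \<open>lipschitz_units\<close> below).
\<close>

type_synonym quat = "int \<times> int \<times> int \<times> int"

definition quat_mod :: "nat \<Rightarrow> quat \<Rightarrow> quat" where
  "quat_mod n = (\<lambda>(a, b, c, d). (a mod int n, b mod int n, c mod int n, d mod int n))"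

definition quat_add :: "quat \<Rightarrow> quat \<Rightarrow> quat" where
  "quat_add = (\<lambda>(a, b, c, d) (a', b', c', d'). (a + a', b + b', c + c', d + d'))"

definition quat_mult :: "quat \<Rightarrow> quat \<Rightarrow> quat" where
  "quat_mult = (\<lambda>(a, b, c, d) (a', b', c', d').
     (a * a' - b * b' - c * c' - d * d',
      a * b' + b * a' + c * d' - d * c',
      a * c' - b * d' + c * a' + d * b',
      a * d' + b * c' - c * b' + d * a'))"

definition lipschitz :: "nat \<Rightarrow> quat ring" where
  "lipschitz n =
     \<lparr>carrier = {0..<int n} \<times> {0..<int n} \<times> {0..<int n} \<times> {0..<int n},
      monoid.mult = \<lambda>x y. quat_mod n (quat_mult x y),
      one = quat_mod n (1, 0, 0, 0),
      zero = (0, 0, 0, 0),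
      add = \<lambda>x y. quat_mod n (quat_add x y)\<rparr>"

lemma quat_mod_mult [simp]:
  "quat_mod n (quat_mult (quat_mod n x) y) = quat_mod n (quat_mult x y)"
  "quat_mod n (quat_mult x (quat_mod n y)) = quat_mod n (quat_mult x y)"
  by (auto simp: quat_mult_def quat_mod_def split: prod.splits
      intro!: mod_add_cong mod_diff_cong mod_mult_cong)

lemma quat_mult_assoc: "quat_mult (quat_mult x y) z = quat_mult x (quat_mult y z)"
  by (auto simp: quat_mult_def algebra_simps split: prod.splits)

lemma quat_mod_add [simp]:
  "quat_mod n (quat_add (quat_mod n x) y) = quat_mod n (quat_add x y)"
  "quat_mod n (quat_add x (quat_mod n y)) = quat_mod n (quat_add x y)"
  by (auto simp: quat_add_def quat_mod_def mod_simps split: prod.splits)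

lemma quat_mult_add:
  "quat_mult (quat_add x y) z = quat_add (quat_mult x z) (quat_mult y z)"
  "quat_mult z (quat_add x y) = quat_add (quat_mult z x) (quat_mult z y)"
  by (auto simp: quat_add_def quat_mult_def algebra_simps split: prod.splits)

lemma ring_lipschitz:
  assumes "n \<ge> 2"
  shows "ring (lipschitz n)"
proof -
  have n: "int n > 0" "int n > 1" using assms by auto
  show ?thesis
  proof (rule ringI)
    show "abelian_group (lipschitz n)"
    proof (rule abelian_groupI)
      fix x assume "x \<in> carrier (lipschitz n)"
      then show "\<exists>y\<in>carrier (lipschitz n). y \<oplus>\<^bsub>lipschitz n\<^esub> x = \<zero>\<^bsub>lipschitz n\<^esub>"
        using n
        by (intro bexI[of _ "quat_mod n (case x of (a, b, c, d) \<Rightarrow> (- a, - b, - c, - d))"])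
          (auto simp: lipschitz_def quat_add_def quat_mod_def mod_simps)
    qed (use n in \<open>auto simp: lipschitz_def quat_add_def quat_mod_def mod_simps ac_simps\<close>)
    have mod: "quat_mod n x \<in> carrier (lipschitz n)" for x
      using n by (auto simp: lipschitz_def quat_mod_def split: prod.splits)
    show "Group.monoid (lipschitz n)"
    proof (rule monoidI)
      fix x y z
      show "x \<otimes>\<^bsub>lipschitz n\<^esub> y \<otimes>\<^bsub>lipschitz n\<^esub> z = x \<otimes>\<^bsub>lipschitz n\<^esub> (y \<otimes>\<^bsub>lipschitz n\<^esub> z)"
        by (simp add: lipschitz_def quat_mult_assoc)
      show "x \<otimes>\<^bsub>lipschitz n\<^esub> y \<in> carrier (lipschitz n)" "\<one>\<^bsub>lipschitz n\<^esub> \<in> carrier (lipschitz n)"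
        using mod by (simp_all add: lipschitz_def)
    qed (use n in \<open>auto simp: lipschitz_def quat_mult_def quat_mod_def\<close>)
  qed (simp_all add: lipschitz_def quat_mult_add)
qed

lemma lipschitz_units:
  fixes n :: nat
  defines "L \<equiv> lipschitz n" and "i \<equiv> (0, 1, 0, 0)" and "j \<equiv> (0, 0, 1, 0)" and "k \<equiv> (0, 0, 0, 1)"
  assumes "n \<ge> 2"
  shows "i \<otimes>\<^bsub>L\<^esub> i = \<ominus>\<^bsub>L\<^esub> \<one>\<^bsub>L\<^esub>" "j \<otimes>\<^bsub>L\<^esub> j = \<ominus>\<^bsub>L\<^esub> \<one>\<^bsub>L\<^esub>" "k \<otimes>\<^bsub>L\<^esub> k = \<ominus>\<^bsub>L\<^esub> \<one>\<^bsub>L\<^esub>"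
    and "i \<otimes>\<^bsub>L\<^esub> j = k" "j \<otimes>\<^bsub>L\<^esub> k = i" "k \<otimes>\<^bsub>L\<^esub> i = j"
    and "j \<otimes>\<^bsub>L\<^esub> i = \<ominus>\<^bsub>L\<^esub> k" "k \<otimes>\<^bsub>L\<^esub> j = \<ominus>\<^bsub>L\<^esub> i" "i \<otimes>\<^bsub>L\<^esub> k = \<ominus>\<^bsub>L\<^esub> j"
proof -
  interpret ring L unfolding L_def using assms(5) by (rule ring_lipschitz)
  have n: "int n > 1" using assms(5) by auto
  note defs = L_def i_def j_def k_def lipschitz_def quat_add_def quat_mult_def quat_mod_def
  have carr: "i \<in> carrier L" "j \<in> carrier L" "k \<in> carrier L"
    using n by (auto simp: defs)
  have cl: "i \<otimes>\<^bsub>L\<^esub> i \<in> carrier L" "j \<otimes>\<^bsub>L\<^esub> j \<in> carrier L" "k \<otimes>\<^bsub>L\<^esub> k \<in> carrier L"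
    "j \<otimes>\<^bsub>L\<^esub> i \<in> carrier L" "k \<otimes>\<^bsub>L\<^esub> j \<in> carrier L" "i \<otimes>\<^bsub>L\<^esub> k \<in> carrier L"
    using carr by auto
  show "i \<otimes>\<^bsub>L\<^esub> j = k" "j \<otimes>\<^bsub>L\<^esub> k = i" "k \<otimes>\<^bsub>L\<^esub> i = j"
    using n by (auto simp: defs)
  have "(i \<otimes>\<^bsub>L\<^esub> i) \<oplus>\<^bsub>L\<^esub> \<one>\<^bsub>L\<^esub> = \<zero>\<^bsub>L\<^esub>" "(j \<otimes>\<^bsub>L\<^esub> j) \<oplus>\<^bsub>L\<^esub> \<one>\<^bsub>L\<^esub> = \<zero>\<^bsub>L\<^esub>" "(k \<otimes>\<^bsub>L\<^esub> k) \<oplus>\<^bsub>L\<^esub> \<one>\<^bsub>L\<^esub> = \<zero>\<^bsub>L\<^esub>"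
    "(j \<otimes>\<^bsub>L\<^esub> i) \<oplus>\<^bsub>L\<^esub> k = \<zero>\<^bsub>L\<^esub>" "(k \<otimes>\<^bsub>L\<^esub> j) \<oplus>\<^bsub>L\<^esub> i = \<zero>\<^bsub>L\<^esub>" "(i \<otimes>\<^bsub>L\<^esub> k) \<oplus>\<^bsub>L\<^esub> j = \<zero>\<^bsub>L\<^esub>"
    using n by (auto simp: defs mod_simps)
  then show "i \<otimes>\<^bsub>L\<^esub> i = \<ominus>\<^bsub>L\<^esub> \<one>\<^bsub>L\<^esub>" "j \<otimes>\<^bsub>L\<^esub> j = \<ominus>\<^bsub>L\<^esub> \<one>\<^bsub>L\<^esub>" "k \<otimes>\<^bsub>L\<^esub> k = \<ominus>\<^bsub>L\<^esub> \<one>\<^bsub>L\<^esub>"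
    "j \<otimes>\<^bsub>L\<^esub> i = \<ominus>\<^bsub>L\<^esub> k" "k \<otimes>\<^bsub>L\<^esub> j = \<ominus>\<^bsub>L\<^esub> i" "i \<otimes>\<^bsub>L\<^esub> k = \<ominus>\<^bsub>L\<^esub> j"
    using cl carr by (metis minus_equality one_closed)+
qed

definition zero_divisors :: "('a, 'm) ring_scheme \<Rightarrow> 'a set" where
  "zero_divisors R = {x \<in> carrier R. x \<noteq> \<zero>\<^bsub>R\<^esub> \<and>
     (\<exists>y\<in>carrier R. y \<noteq> \<zero>\<^bsub>R\<^esub> \<and> (x \<otimes>\<^bsub>R\<^esub> y = \<zero>\<^bsub>R\<^esub> \<or> y \<otimes>\<^bsub>R\<^esub> x = \<zero>\<^bsub>R\<^esub>))}"

text \<open>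
  Simple undirected graphs are loop-free symmetric digraphs, as in \<^theory>\<open>Graph_Theory.Digraph\<close>:
  an undirected edge is a pair of opposite arcs.
\<close>

definition zero_divisor_graph :: "('a, 'm) ring_scheme \<Rightarrow> 'a pair_pre_digraph" where
  "zero_divisor_graph R =
     \<lparr>pverts = zero_divisors R,
      parcs = {(x, y). x \<in> zero_divisors R \<and> y \<in> zero_divisors R \<and> x \<noteq> y \<and>
                 (x \<otimes>\<^bsub>R\<^esub> y = \<zero>\<^bsub>R\<^esub> \<or> y \<otimes>\<^bsub>R\<^esub> x = \<zero>\<^bsub>R\<^esub>)}\<rparr>"

lemma pair_graph_zero_divisor_graph:
  assumes "finite (carrier R)"
  shows "pair_graph (zero_divisor_graph R)"
proof -
  have fin: "finite (zero_divisors R)"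
    using assms by (simp add: zero_divisors_def)
  have "finite (parcs (zero_divisor_graph R))"
    by (rule finite_subset[of _ "zero_divisors R \<times> zero_divisors R"])
      (use fin in \<open>auto simp: zero_divisor_graph_def\<close>)
  with fin show ?thesis
    by unfold_locales (auto simp: zero_divisor_graph_def symmetric_def sym_def)
qed

definition lipschitz_graph :: "nat \<Rightarrow> quat pair_pre_digraph" where
  "lipschitz_graph n = zero_divisor_graph (lipschitz n)"

lemma pair_graph_lipschitz_graph: "pair_graph (lipschitz_graph n)"
  unfolding lipschitz_graph_def
  by (rule pair_graph_zero_divisor_graph) (simp add: lipschitz_def)

definition undirected_edges :: "'a pair_pre_digraph \<Rightarrow> 'a set set" where
  "undirected_edges G = {{x, y} | x y. (x, y) \<in> parcs G}"

text \<open>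
  The adjacency matrix depends on an enumeration \<open>vs\<close> of the vertices without repetition; the
  spectrum does not. The entries are complex because \<^const>\<open>spectral_radius\<close> is defined for
  complex matrices.
\<close>

definition adjacency_matrix :: "'a pair_pre_digraph \<Rightarrow> 'a list \<Rightarrow> complex mat" where
  "adjacency_matrix G vs =
     mat (length vs) (length vs) (\<lambda>(i, j). if (vs ! i, vs ! j) \<in> parcs G then 1 else 0)"

definition two_power_ideal :: "nat \<Rightarrow> nat \<Rightarrow> quat set" where
  "two_power_ideal t r =
     {[(2 ^ r :: nat)] \<cdot>\<^bsub>lipschitz (2 ^ t)\<^esub> x | x. x \<in> carrier (lipschitz (2 ^ t))}"

end

theory Submission
  imports Defs
begin

text \<open>
  An element of \<open>I\<^sub>r = 2\<^sup>r L\<close> with \<open>r \<le> t\<close> is a quaternion whose four coordinates are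
  divisible by \<open>2\<^sup>r\<close> (lemma \<open>two_power_ideal_eq\<close>).  The coordinates of a product are therefore divisible by
  \<open>2\<^bsup>a+b\<^esup>\<close> as soon as the factors lie in \<open>I\<^sub>a\<close> and \<open>I\<^sub>b\<close>, and this kills the product
  modulo \<open>2\<^sup>t\<close> because \<open>a + b \<ge> t\<close> (lemma \<open>two_power_ideal_mult_eq_zero\<close>).  Hence \<open>X\<close> and \<open>Y\<close>
  annihilate each other.  Both are nonempty, so they consist of zero divisors and are completely
  joined; the parameters of the complete bipartite subgraph come from \<open>|I\<^sub>r| = (2\<^bsup>t-r\<^esup>)\<^sup>4\<close>.

  The number of edges is bounded below by counting the edges between \<open>X\<close> and \<open>Y\<close>.  For the
  spectral radius, the Perron vector of \<open>K\<^bsub>m,n\<^esub>\<close> (constantly \<open>\<surd>n\<close> on the side of size \<open>m\<close> and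
  \<open>\<surd>m\<close> on the side of size \<open>n\<close>), extended by zero to the remaining vertices, is a nonnegative
  vector \<open>v\<close> with \<open>A v \<ge> \<surd>(m n) v\<close>.  By the Collatz-Wielandt bound (lemma
  \<open>spectral_radius_ge_of_subinvariant\<close>), the existence of such a vector forces
  \<open>\<rho>(A) \<ge> \<surd>(m n)\<close>.  That bound in turn rests on the boundedness of the powers of a matrix
  whose spectral radius is below one.
\<close>

section \<open>A lower bound for the spectral radius of a nonnegative matrix\<close>

lemma spectral_radius_smult_less_one:
  fixes A :: "complex mat"
  assumes A: "A \<in> carrier_mat N N" and N: "N > 0"
    and r: "r > 0" "spectral_radius A < r"
  shows "spectral_radius (complex_of_real (1 / r) \<cdot>\<^sub>m A) < 1"
proof -
  let ?C = "complex_of_real (1 / r) \<cdot>\<^sub>m A"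
  have C: "?C \<in> carrier_mat N N" using A by simp
  obtain e where e: "e \<in> spectrum ?C" "spectral_radius ?C = norm e"
    using spectral_radius_mem_max(1)[OF C N] by auto
  then obtain v where v: "v \<in> carrier_vec N" "v \<noteq> 0\<^sub>v N" "?C *\<^sub>v v = e \<cdot>\<^sub>v v"
    using C A unfolding spectrum_def eigenvalue_def eigenvector_def by auto
  have "A *\<^sub>v v = (of_real r * e) \<cdot>\<^sub>v v"
  proof (rule eq_vecI)
    show "dim_vec (A *\<^sub>v v) = dim_vec ((of_real r * e) \<cdot>\<^sub>v v)" using A v by simp
    fix i assume "i < dim_vec ((of_real r * e) \<cdot>\<^sub>v v)"
    then have i: "i < N" using v by simp
    have "(?C *\<^sub>v v) $ i = (e \<cdot>\<^sub>v v) $ i" using v by simp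
    then have "of_real (1 / r) * (A *\<^sub>v v) $ i = e * v $ i"
      using A v i by (simp add: scalar_prod_def sum_distrib_left mult.assoc)
    then have "of_real r * (of_real (1 / r) * (A *\<^sub>v v) $ i) = of_real r * (e * v $ i)"
      by simp
    then show "(A *\<^sub>v v) $ i = ((of_real r * e) \<cdot>\<^sub>v v) $ i"
      using r v i by simp
  qed
  then have "of_real r * e \<in> spectrum A"
    using v A unfolding spectrum_def eigenvalue_def eigenvector_def by auto
  then have "norm (of_real r * e) \<le> spectral_radius A"
    using spectral_radius_mem_max(2)[OF A N] by blast
  then have "r * norm e \<le> spectral_radius A" using r(1) by (simp add: norm_mult)
  then have "r * norm e < r * 1" using r(2) by linarith
  then show ?thesis using r(1) e(2) mult_less_cancel_left_pos[OF r(1)] by metis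
qed

lemma pow_mat_Suc_left:
  assumes "A \<in> carrier_mat N N"
  shows "A ^\<^sub>m Suc k = A * A ^\<^sub>m k"
proof (induction k)
  case (Suc k)
  have "A ^\<^sub>m Suc (Suc k) = (A * A ^\<^sub>m k) * A" using Suc by simp
  also have "\<dots> = A * (A ^\<^sub>m k * A)"
    using assms by (intro assoc_mult_mat[of _ N N _ N _ N]) simp_all
  finally show ?case by simp
qed (use assms in simp)

text \<open>
  Multiplication by an entrywise nonnegative matrix preserves coordinatewise inequalities between
  vectors, so the inequality \<open>C v \<ge> q v\<close> can be iterated.
\<close>

lemma nonneg_mat_pow_mult_vec_ge:
  fixes C :: "real mat"
  assumes C: "C \<in> carrier_mat N N" and v: "v \<in> carrier_vec N"
    and nonneg: "\<And>i j. i < N \<Longrightarrow> j < N \<Longrightarrow> C $$ (i, j) \<ge> 0"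
    and q: "q \<ge> 0" and ge: "\<And>i. i < N \<Longrightarrow> (C *\<^sub>v v) $ i \<ge> q * v $ i"
    and i: "i < N"
  shows "(C ^\<^sub>m k *\<^sub>v v) $ i \<ge> q ^ k * v $ i"
  using i
proof (induction k arbitrary: i)
  case 0
  then show ?case using C v by simp
next
  case (Suc k)
  have "C ^\<^sub>m k \<in> carrier_mat N N" using C by simp
  then have w: "C ^\<^sub>m k *\<^sub>v v \<in> carrier_vec N" using v by (rule mult_mat_vec_carrier)
  have step: "C ^\<^sub>m Suc k *\<^sub>v v = C *\<^sub>v (C ^\<^sub>m k *\<^sub>v v)"
    using C v by (simp only: pow_mat_Suc_left[OF C] assoc_mult_mat_vec[of _ N N _ N] pow_carrier_mat)
  have "q ^ k * (q * v $ i) \<le> q ^ k * (C *\<^sub>v v) $ i"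
    using ge[OF Suc.prems] q by (intro mult_left_mono) auto
  also have "\<dots> = (\<Sum>j<N. C $$ (i, j) * (q ^ k * v $ j))"
    using C v Suc.prems
    by (simp add: scalar_prod_def lessThan_atLeast0 sum_distrib_left mult_ac)
  also have "\<dots> \<le> (\<Sum>j<N. C $$ (i, j) * (C ^\<^sub>m k *\<^sub>v v) $ j)"
    using Suc by (intro sum_mono mult_left_mono nonneg) auto
  also have "\<dots> = (C ^\<^sub>m Suc k *\<^sub>v v) $ i"
    unfolding step using C w Suc.prems by (simp add: scalar_prod_def lessThan_atLeast0)
  finally show ?case by (simp add: mult_ac)
qed

text \<open>
  If the spectral radius were below \<open>s\<close>, one could pick \<open>r\<close> strictly between the two.  The
  powers of \<open>A / r\<close> are then bounded, whereas iterating \<open>A v \<ge> s v\<close> makes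
  \<open>(A / r)\<^sup>k v\<close> grow at least like \<open>(s / r)\<^sup>k\<close> at a coordinate where \<open>v\<close> is positive.
\<close>

lemma spectral_radius_ge_of_subinvariant:
  fixes A :: "real mat"
  assumes A: "A \<in> carrier_mat N N" and v: "v \<in> carrier_vec N"
    and A_nonneg: "\<And>i j. i < N \<Longrightarrow> j < N \<Longrightarrow> A $$ (i, j) \<ge> 0"
    and v_nonneg: "\<And>i. i < N \<Longrightarrow> v $ i \<ge> 0"
    and p: "p < N" "v $ p > 0"
    and ge: "\<And>i. i < N \<Longrightarrow> (A *\<^sub>v v) $ i \<ge> s * v $ i"
  shows "spectral_radius (map_mat complex_of_real A) \<ge> s"
proof (rule ccontr)
  let ?A = "map_mat complex_of_real A"
  have cA: "?A \<in> carrier_mat N N" using A by simp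
  have N: "N > 0" using p by simp
  assume "\<not> ?thesis"
  then obtain r where r: "spectral_radius ?A < r" "r < s"
    using dense by (auto simp: not_le)
  have "spectral_radius ?A \<ge> 0"
    using spectral_radius_mem_max(1)[OF cA N] by auto
  then have r0: "r > 0" using r by simp
  define C where "C = (1 / r) \<cdot>\<^sub>m A"
  have C: "C \<in> carrier_mat N N" using A by (simp add: C_def)
  have cC: "map_mat complex_of_real C = complex_of_real (1 / r) \<cdot>\<^sub>m ?A"
    unfolding C_def by (rule eq_matI) auto
  have "spectral_radius (map_mat complex_of_real C) < 1"
    unfolding cC using cA N r0 r(1) by (rule spectral_radius_smult_less_one)
  then have "\<exists>c. \<forall>k. norm_bound (map_mat complex_of_real C ^\<^sub>m k) c"
    using C by (intro spectral_radius_jnf_norm_bound_less_1_upper_triangular[of _ N]) simp_all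
  then obtain c where c: "\<And>k. norm_bound (map_mat complex_of_real C ^\<^sub>m k) c" by blast
  have entry_le: "(C ^\<^sub>m k) $$ (i, j) \<le> c" if "i < N" "j < N" for k i j
  proof -
    have dim: "C ^\<^sub>m k \<in> carrier_mat N N" using C by simp
    have "norm_bound (map_mat complex_of_real (C ^\<^sub>m k)) c"
      using c[of k] of_real_hom.mat_hom_pow[OF C, of k] by metis
    then have "norm (map_mat complex_of_real (C ^\<^sub>m k) $$ (i, j)) \<le> c"
      using that unfolding norm_bound_def index_map_mat carrier_matD[OF dim] by blast
    then have "\<bar>(C ^\<^sub>m k) $$ (i, j)\<bar> \<le> c" using that carrier_matD[OF dim] by (simp del: pow_mat_dim)
    then show ?thesis by linarith
  qed
  define q where "q = s / r"
  have q: "q > 1" using r r0 by (simp add: q_def)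
  have bound: "q ^ k * v $ p \<le> c * (\<Sum>j<N. v $ j)" for k
  proof -
    have Cv: "(C *\<^sub>v v) $ i \<ge> q * v $ i" if "i < N" for i
    proof -
      have "(C *\<^sub>v v) $ i = (A *\<^sub>v v) $ i / r"
        using A v that by (simp add: C_def scalar_prod_def sum_divide_distrib)
      then show ?thesis using ge[OF that] r0 by (simp add: q_def divide_right_mono)
    qed
    have "q ^ k * v $ p \<le> (C ^\<^sub>m k *\<^sub>v v) $ p"
    proof (rule nonneg_mat_pow_mult_vec_ge[OF C v _ _ Cv p(1)])
      show "C $$ (i, j) \<ge> 0" if "i < N" "j < N" for i j
        using A_nonneg[OF that] that A r0 by (simp add: C_def)
    qed (use q in auto)
    also have "(C ^\<^sub>m k *\<^sub>v v) $ p = (\<Sum>j<N. (C ^\<^sub>m k) $$ (p, j) * v $ j)"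
      using v p(1) carrier_matD[OF pow_carrier_mat[OF C, of k]]
      by (simp add: scalar_prod_def lessThan_atLeast0 del: pow_mat_dim)
    also have "\<dots> \<le> (\<Sum>j<N. c * v $ j)"
      using entry_le p(1) v_nonneg by (intro sum_mono mult_right_mono) auto
    finally show ?thesis by (simp add: sum_distrib_left)
  qed
  obtain k where "c * (\<Sum>j<N. v $ j) / v $ p < q ^ k"
    using real_arch_pow[OF q] by blast
  then have "c * (\<Sum>j<N. v $ j) < q ^ k * v $ p"
    using p(2) by (simp add: pos_divide_less_eq)
  with bound[of k] show False by simp
qed

section \<open>Completely joined vertex sets\<close>

lemma sum_nth_indicator:
  fixes f :: "'a \<Rightarrow> real"
  assumes "distinct vs" "U \<subseteq> set vs"
  shows "(\<Sum>j<length vs. if vs ! j \<in> U then f (vs ! j) else 0) = sum f U"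
proof -
  have "(\<Sum>j<length vs. if vs ! j \<in> U then f (vs ! j) else 0)
      = (\<Sum>x\<in>set vs. if x \<in> U then f x else 0)"
    by (rule sum.reindex_bij_betw[OF bij_betw_nth]) (use assms in auto)
  also have "\<dots> = sum f U"
    using assms(2) by (simp add: sum.If_cases Int_absorb1)
  finally show ?thesis .
qed

context pair_graph
begin

lemma complete_bipartite_subgraph_if_joined:
  assumes "U \<subseteq> pverts G" "V \<subseteq> pverts G" "U \<inter> V = {}" "U \<times> V \<subseteq> parcs G"
  shows "\<exists>H :: 'a pair_pre_digraph. subgraph (with_proj H) (with_proj G) \<and>
    complete_bipartite_digraph (card U) (card V) (with_proj H)"
proof (intro exI conjI)
  let ?H = "\<lparr>pverts = U \<union> V, parcs = U \<times> V \<union> V \<times> U\<rparr>"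
  have rev: "V \<times> U \<subseteq> parcs G"
    using assms(4) arcs_symmetric by auto
  have fin: "finite (U \<union> V)"
    using assms(1,2) finite_verts by (metis finite_Un finite_subset)
  show bip: "complete_bipartite_digraph (card U) (card V) (with_proj ?H)"
    unfolding complete_bipartite_digraph_pair_def using assms(3) fin by auto
  have "wf_digraph (with_proj ?H)"
    by unfold_locales auto
  moreover have "wf_digraph (with_proj G)" by unfold_locales
  ultimately show "subgraph (with_proj ?H) (with_proj G)"
    unfolding subgraph_def using assms rev by (auto simp: compatible_def)
qed

text \<open>
  Disjointness of \<open>U\<close> and \<open>V\<close> makes an undirected edge between them determine which of its
  ends lies in \<open>U\<close>.
\<close>

lemma card_undirected_edges_ge_if_joined:
  assumes "U \<inter> V = {}" "U \<times> V \<subseteq> parcs G"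
  shows "card (undirected_edges G) \<ge> card U * card V"
proof -
  have "undirected_edges G = (\<lambda>(x, y). {x, y}) ` parcs G"
    by (auto simp: undirected_edges_def)
  then have fin: "finite (undirected_edges G)" using finite_arcs by simp
  have "inj_on (\<lambda>(x, y). {x, y}) (U \<times> V)"
    using assms(1) by (auto simp: inj_on_def doubleton_eq_iff)
  then have "card U * card V = card ((\<lambda>(x, y). {x, y}) ` (U \<times> V))"
    by (simp add: card_image card_cartesian_product)
  also have "\<dots> \<le> card (undirected_edges G)"
    using assms(2) by (intro card_mono[OF fin]) (auto simp: undirected_edges_def)
  finally show ?thesis .
qed

text \<open>
  The test vector is the Perron vector of the complete bipartite graph on \<open>U\<close> and \<open>V\<close>: at a
  vertex of \<open>U\<close> the neighbours in \<open>V\<close> contribute \<open>|V| \<surd>|U| = \<surd>(|U| |V|) \<surd>|V|\<close>, and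
  symmetrically on \<open>V\<close>.  All other arcs of the graph only add nonnegative terms.
\<close>

lemma spectral_radius_adjacency_ge_if_joined:
  assumes disj: "U \<inter> V = {}" and joined: "U \<times> V \<subseteq> parcs G"
    and ne: "U \<noteq> {}" "V \<noteq> {}"
    and vs: "distinct vs" "set vs = pverts G"
  shows "spectral_radius (adjacency_matrix G vs) \<ge> sqrt (real (card U * card V))"
proof -
  let ?N = "length vs"
  have rev: "V \<times> U \<subseteq> parcs G" using joined arcs_symmetric by auto
  have UV: "U \<subseteq> set vs" "V \<subseteq> set vs"
    using joined ne vs(2) in_arcsD1 in_arcsD2 by blast+
  then have pos: "card U > 0" "card V > 0"
    using ne by (meson card_gt_0_iff finite_set finite_subset)+
  define u v where "u = sqrt (real (card U))" and "v = sqrt (real (card V))"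
  have uv: "u > 0" "v > 0" "u * u = card U" "v * v = card V"
    using pos by (simp_all add: u_def v_def)
  define f where "f = (\<lambda>x. if x \<in> U then v else if x \<in> V then u else 0)"
  have f_nonneg: "f x \<ge> 0" for x using uv by (simp add: f_def)
  define A where "A = mat ?N ?N (\<lambda>(i, j). if (vs ! i, vs ! j) \<in> parcs G then 1 else (0::real))"
  define w where "w = vec ?N (\<lambda>i. f (vs ! i))"
  have adj: "adjacency_matrix G vs = map_mat complex_of_real A"
    by (rule eq_matI) (auto simp: adjacency_matrix_def A_def)
  have Aw: "(A *\<^sub>v w) $ i = (\<Sum>j<?N. if (vs ! i, vs ! j) \<in> parcs G then f (vs ! j) else 0)"
    if "i < ?N" for i
    using that by (auto simp: A_def w_def scalar_prod_def lessThan_atLeast0 intro!: sum.cong)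
  have Aw_ge: "(A *\<^sub>v w) $ i \<ge> sum f W"
    if "i < ?N" "W \<subseteq> set vs" "{vs ! i} \<times> W \<subseteq> parcs G" for i W
  proof -
    have "sum f W = (\<Sum>j<?N. if vs ! j \<in> W then f (vs ! j) else 0)"
      by (rule sum_nth_indicator[symmetric, OF vs(1) that(2)])
    also have "\<dots> \<le> (A *\<^sub>v w) $ i"
      unfolding Aw[OF that(1)] using that(3) f_nonneg by (intro sum_mono) auto
    finally show ?thesis .
  qed
  have sumU: "sum f U = card U * v" by (simp add: f_def)
  have "sum f V = (\<Sum>x\<in>V. u)" using disj by (intro sum.cong) (auto simp: f_def)
  then have sumV: "sum f V = card V * u" by simp
  obtain x where x: "x \<in> U" using ne by blast
  then obtain p where p: "p < ?N" "vs ! p = x" using UV by (metis in_set_conv_nth subsetD)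
  have "spectral_radius (map_mat complex_of_real A) \<ge> u * v"
  proof (rule spectral_radius_ge_of_subinvariant[of _ ?N w])
    show "p < ?N" "w $ p > 0" using p x uv by (auto simp: w_def f_def)
    fix i assume i: "i < ?N"
    then show "w $ i \<ge> 0" using f_nonneg by (simp add: w_def)
    have wi: "w $ i = f (vs ! i)" using i by (simp add: w_def)
    consider "vs ! i \<in> U" | "vs ! i \<in> V" | "vs ! i \<notin> U \<union> V" by blast
    then show "(A *\<^sub>v w) $ i \<ge> u * v * w $ i"
    proof cases
      case 1
      then have "(A *\<^sub>v w) $ i \<ge> card V * u"
        using Aw_ge[OF i UV(2)] joined sumV by auto
      moreover have "u * v * w $ i = card V * u"
        using 1 wi uv(4) by (simp add: f_def mult_ac flip: uv(4))
      ultimately show ?thesis by linarith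
    next
      case 2
      then have "vs ! i \<notin> U" using disj by auto
      have "(A *\<^sub>v w) $ i \<ge> card U * v"
        using Aw_ge[OF i UV(1)] rev sumU 2 by auto
      moreover have "u * v * w $ i = card U * v"
        using 2 \<open>vs ! i \<notin> U\<close> wi by (simp add: f_def mult_ac flip: uv(3))
      ultimately show ?thesis by linarith
    next
      case 3
      then show ?thesis using wi Aw[OF i] f_nonneg by (simp add: f_def sum_nonneg)
    qed
  qed (auto simp: A_def w_def)
  then show ?thesis by (simp add: adj u_def v_def real_sqrt_mult)
qed

end

section \<open>The ideals generated by powers of two\<close>

lemma lipschitz_zero: "\<zero>\<^bsub>lipschitz N\<^esub> = (0, 0, 0, 0)"
  by (simp add: lipschitz_def)

lemma lipschitz_nat_multiple:
  assumes "N \<ge> 2" and x: "(a, b, c, d) \<in> carrier (lipschitz N)"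
  shows "[(k :: nat)] \<cdot>\<^bsub>lipschitz N\<^esub> (a, b, c, d)
    = quat_mod N (int k * a, int k * b, int k * c, int k * d)"
proof (induction k)
  interpret ring "lipschitz N" using assms(1) by (rule ring_lipschitz)
  case 0
  show ?case
    using add.nat_pow_0[of "(a, b, c, d)"] by (simp add: lipschitz_zero quat_mod_def)
next
  interpret ring "lipschitz N" using assms(1) by (rule ring_lipschitz)
  case (Suc k)
  have "[Suc k] \<cdot>\<^bsub>lipschitz N\<^esub> (a, b, c, d)
      = [k] \<cdot>\<^bsub>lipschitz N\<^esub> (a, b, c, d) \<oplus>\<^bsub>lipschitz N\<^esub> (a, b, c, d)"
    using x by (simp add: add.nat_pow_Suc)
  then show ?case
    using Suc by (simp add: lipschitz_def quat_mod_def quat_add_def mod_simps algebra_simps)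
qed

definition residue_multiples :: "nat \<Rightarrow> nat \<Rightarrow> int set" where
  "residue_multiples t r = {z \<in> {0..<2 ^ t}. 2 ^ r dvd z}"

lemma card_residue_multiples:
  assumes "r \<le> t"
  shows "card (residue_multiples t r) = 2 ^ (t - r)"
proof -
  have t: "(2::int) ^ t = 2 ^ r * 2 ^ (t - r)"
    using assms by (simp flip: power_add)
  have "residue_multiples t r = (\<lambda>q. 2 ^ r * q) ` {0..<2 ^ (t - r)}"
    unfolding residue_multiples_def t by (auto simp: zero_le_mult_iff elim!: dvdE)
  then show ?thesis
    by (simp add: card_image inj_on_def nat_power_eq)
qed

text \<open>
  Reduction modulo \<open>2\<^sup>t\<close> preserves divisibility by \<open>2\<^sup>r\<close> because \<open>r \<le> t\<close>, so the ideal is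
  described by independent divisibility conditions on the canonical representatives of the four
  coordinates.
\<close>

lemma two_power_ideal_eq:
  assumes "t \<ge> 1" "r \<le> t"
  defines "D \<equiv> residue_multiples t r"
  shows "two_power_ideal t r = D \<times> D \<times> D \<times> D"
proof -
  let ?L = "lipschitz (2 ^ t)"
  have N: "(2::nat) ^ t \<ge> 2" using assms(1) power_increasing[of 1 t "2::nat"] by simp
  have carr: "carrier ?L = {0..<2 ^ t} \<times> {0..<2 ^ t} \<times> {0..<2 ^ t} \<times> {0..<2 ^ t}"
    by (simp add: lipschitz_def)
  have mod_mem: "2 ^ r * z mod 2 ^ t \<in> D" for z :: int
    using assms(2) by (auto simp: D_def residue_multiples_def le_imp_power_dvd intro!: dvd_mod)
  show ?thesis
  proof (intro subset_antisym subsetI)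
    fix x assume "x \<in> two_power_ideal t r"
    then obtain a b c d where "(a, b, c, d) \<in> carrier ?L"
      and "x = [(2 ^ r :: nat)] \<cdot>\<^bsub>?L\<^esub> (a, b, c, d)"
      unfolding two_power_ideal_def by auto
    then show "x \<in> D \<times> D \<times> D \<times> D"
      using mod_mem by (simp add: lipschitz_nat_multiple[OF N] quat_mod_def)
  next
    fix x assume "x \<in> D \<times> D \<times> D \<times> D"
    then obtain a b c d where x: "x = (a, b, c, d)" and D: "a \<in> D" "b \<in> D" "c \<in> D" "d \<in> D"
      by auto
    \<comment> \<open>Divide each coordinate by \<open>2\<^sup>r\<close>; the quotient is already a canonical representative.\<close>
    define h :: "int \<Rightarrow> int" where "h z = z div 2 ^ r" for z
    have h: "2 ^ r * h z mod 2 ^ t = z" "h z \<in> {0..<2 ^ t}" if "z \<in> D" for z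
    proof -
      have z: "0 \<le> z" "z < 2 ^ t" "2 ^ r dvd z"
        using that by (auto simp: D_def residue_multiples_def)
      show "2 ^ r * h z mod 2 ^ t = z" using z by (simp add: h_def)
      have "h z \<le> z" using z by (simp add: h_def zdiv_mono2[of z 1 "2 ^ r", simplified])
      then show "h z \<in> {0..<2 ^ t}" using z by (simp add: h_def pos_imp_zdiv_nonneg_iff)
    qed
    have "(h a, h b, h c, h d) \<in> carrier ?L" using D h(2) by (simp add: carr)
    moreover from this have "x = [(2 ^ r :: nat)] \<cdot>\<^bsub>?L\<^esub> (h a, h b, h c, h d)"
      using D by (simp add: x lipschitz_nat_multiple[OF N] quat_mod_def h(1))
    ultimately show "x \<in> two_power_ideal t r" unfolding two_power_ideal_def by blast
  qed
qed

lemma card_two_power_ideal: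
  assumes "t \<ge> 1" "r \<le> t"
  shows "card (two_power_ideal t r) = 2 ^ (4 * (t - r))"
proof -
  have "4 * (t - r) = (t - r) + ((t - r) + ((t - r) + (t - r)))" by simp
  then show ?thesis
    by (simp only: two_power_ideal_eq[OF assms] card_cartesian_product
        card_residue_multiples[OF assms(2)] power_add)
qed

lemma two_power_ideal_antimono:
  assumes "t \<ge> 1" "r \<le> s" "s \<le> t"
  shows "two_power_ideal t s \<subseteq> two_power_ideal t r"
proof -
  have "residue_multiples t s \<subseteq> residue_multiples t r"
    using assms(2) by (auto simp: residue_multiples_def intro: power_le_dvd)
  then show ?thesis using assms by (simp add: two_power_ideal_eq Sigma_mono)
qed

lemma zero_in_two_power_ideal:
  assumes "t \<ge> 1" "r \<le> t"
  shows "\<zero>\<^bsub>lipschitz (2 ^ t)\<^esub> \<in> two_power_ideal t r"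
  using assms by (simp add: two_power_ideal_eq residue_multiples_def lipschitz_def)

lemma two_power_ideal_subset_carrier:
  assumes "t \<ge> 1" "r \<le> t"
  shows "two_power_ideal t r \<subseteq> carrier (lipschitz (2 ^ t))"
  using assms by (auto simp: two_power_ideal_eq residue_multiples_def lipschitz_def)

lemma two_power_ideal_mult_eq_zero:
  assumes "t \<ge> 1" "a \<le> t" "b \<le> t" "a + b \<ge> t"
    and "x \<in> two_power_ideal t a" "y \<in> two_power_ideal t b"
  shows "x \<otimes>\<^bsub>lipschitz (2 ^ t)\<^esub> y = \<zero>\<^bsub>lipschitz (2 ^ t)\<^esub>"
proof -
  have dvd: "2 ^ t dvd z * z'" if "z \<in> residue_multiples t a" "z' \<in> residue_multiples t b" for z z'
  proof -
    have "(2::int) ^ a * 2 ^ b dvd z * z'"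
      using that by (intro mult_dvd_mono) (auto simp: residue_multiples_def)
    then show ?thesis using assms(4) by (metis power_add power_le_dvd)
  qed
  show ?thesis
    using assms(5,6)
    unfolding two_power_ideal_eq[OF assms(1,2)] two_power_ideal_eq[OF assms(1,3)]
    by (auto simp: lipschitz_def quat_mult_def quat_mod_def mod_eq_0_iff_dvd
        intro!: dvd_add dvd_diff dvd)
qed

text \<open>
  An element of one side is a zero divisor because it is annihilated by any element of the other
  side.
\<close>

lemma two_power_ideals_joined:
  assumes t: "t \<ge> 1" and ab: "a < b" "b < t" "a + b \<ge> t"
  defines "X \<equiv> two_power_ideal t a - two_power_ideal t b"
    and "Y \<equiv> two_power_ideal t b - {\<zero>\<^bsub>lipschitz (2 ^ t)\<^esub>}"
  assumes ne: "X \<noteq> {}" "Y \<noteq> {}"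
  shows "X \<times> Y \<subseteq> parcs (lipschitz_graph (2 ^ t))"
proof -
  let ?L = "lipschitz (2 ^ t)"
  have le: "a \<le> t" "b \<le> t" using ab by auto
  have carr: "X \<subseteq> carrier ?L" "Y \<subseteq> carrier ?L"
    using two_power_ideal_subset_carrier[OF t] le unfolding X_def Y_def by blast+
  have nz: "\<zero>\<^bsub>?L\<^esub> \<notin> X" "\<zero>\<^bsub>?L\<^esub> \<notin> Y"
    using zero_in_two_power_ideal[OF t le(2)] by (auto simp: X_def Y_def)
  have mult: "x \<otimes>\<^bsub>?L\<^esub> y = \<zero>\<^bsub>?L\<^esub>" if "x \<in> X" "y \<in> Y" for x y
    using two_power_ideal_mult_eq_zero[OF t le ab(3)] that by (auto simp: X_def Y_def)
  obtain x0 y0 where "x0 \<in> X" "y0 \<in> Y" using ne by blast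
  then have "x \<in> zero_divisors ?L" if "x \<in> X" for x
    using carr nz mult that unfolding zero_divisors_def
    by (intro CollectI conjI bexI[of _ y0]) auto
  moreover have "y \<in> zero_divisors ?L" if "y \<in> Y" for y
    using carr nz mult that \<open>x0 \<in> X\<close> unfolding zero_divisors_def
    by (intro CollectI conjI bexI[of _ x0]) auto
  moreover have "X \<inter> Y = {}" by (auto simp: X_def Y_def)
  ultimately show ?thesis
    using mult by (auto simp: lipschitz_graph_def zero_divisor_graph_def)
qed

section \<open>The complete bipartite subgraph\<close>

theorem theorem5p5:
  fixes t a b m n :: nat and X Y :: "quat set" and G :: "quat pair_pre_digraph"
  assumes "t \<ge> 2" and "a < b" and "b < t" and "a + b \<ge> t"
    and "G = lipschitz_graph (2 ^ t)"
    and "X = two_power_ideal t a - two_power_ideal t b"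
    and "Y = two_power_ideal t b - {\<zero>\<^bsub>lipschitz (2 ^ t)\<^esub>}"
    and "m = 2 ^ (4 * (t - a)) - 2 ^ (4 * (t - b))"
    and "n = 2 ^ (4 * (t - b)) - 1"
  shows "X \<inter> Y = {} \<and> (\<forall>x\<in>X. \<forall>y\<in>Y. x \<rightarrow>\<^bsub>with_proj G\<^esub> y)
    \<and> (\<exists>H :: quat pair_pre_digraph.
          subgraph (with_proj H) (with_proj G) \<and> complete_bipartite_digraph m n (with_proj H))
    \<and> (\<forall>vs. distinct vs \<and> set vs = pverts G
          \<longrightarrow> spectral_radius (adjacency_matrix G vs) \<ge> sqrt (real (m * n)))
    \<and> card (undirected_edges G) \<ge> m * n"
proof -
  interpret pair_graph G unfolding assms(5) by (rule pair_graph_lipschitz_graph)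
  have t: "t \<ge> 1" and le: "a \<le> t" "b \<le> t" using assms by auto
  have disj: "X \<inter> Y = {}" using assms by auto
  have "finite (two_power_ideal t b)"
    using card_two_power_ideal[OF t le(2)] by (metis card.infinite power_not_zero zero_neq_numeral)
  moreover have "two_power_ideal t b \<subseteq> two_power_ideal t a"
    using two_power_ideal_antimono[OF t _ le(2)] assms(2) by simp
  ultimately have cards: "card X = m" "card Y = n"
    using zero_in_two_power_ideal[OF t le(2)]
    by (simp_all add: assms(6-9) card_Diff_subset card_two_power_ideal[OF t le(1)]
        card_two_power_ideal[OF t le(2)])
  have "(2::nat) ^ (4 * (t - b)) < 2 ^ (4 * (t - a))" "(1::nat) < 2 ^ (4 * (t - b))"
    using assms(2,3) by (simp, intro one_less_power) auto
  then have "m > 0" "n > 0" using assms(8,9) by auto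
  then have ne: "X \<noteq> {}" "Y \<noteq> {}" using cards by auto
  have joined: "X \<times> Y \<subseteq> parcs G"
    using two_power_ideals_joined[OF t assms(2-4)] ne unfolding assms(5-7) by blast
  then have verts: "X \<subseteq> pverts G" "Y \<subseteq> pverts G"
    using ne in_arcsD1 in_arcsD2 by blast+
  show ?thesis
    using disj joined complete_bipartite_subgraph_if_joined[OF verts disj joined]
      spectral_radius_adjacency_ge_if_joined[OF disj joined ne]
      card_undirected_edges_ge_if_joined[OF disj joined]
    unfolding cards by auto
qed

end
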